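(* Let $H$ be a finite $k$-graph, $v \in V(H)$, and fix a linear ordering $\prec$ of $V(H)$. Let $T(H,v)$ be the $k$-walk-tree of $H$ rooted at $v$ (with respect to $\prec$) and let $V$ be the one-vertex conflict-free walk $(v)$, a vertex of $T(H,v)$. Then $$\frac{m_k(H - v, x)}{m_k(H, x)} = \frac{m_k(T(H,v) - V, x)}{m_k(T(H,v), x)}.$$
   Context: A $k$-graph is a $k$-uniform hypergraph; deleting a vertex removes it and all edges containing it. For an $n$-vertex $k$-graph $H$, its matching polynomial is $m_k(H,x) = \sum_{i=0}^{\lfloor n/k\rfloor} (-1)^i p(H,i) x^{n-ki}$, where $p(H,i)$ is the number of matchings (sets of pairwise vertex-disjoint edges) of size $i$ in $H$, and $p(H,0)=1$. A Berge-path is a sequence $(v_0, e_1, v_1, \dots, e_\ell, v_\ell)$ of distinct vertices $v_0,\dots,v_\ell$ and distinct edges $e_1,\dots,e_\ell$ with $v_{i-1}, v_i \in e_i$ for each $i$. Given a linear ordering $\prec$ of $V(H)$, for such a Berge-path with $\ell \ge 1$ write $e_i = \{v_{i-1}, u_{(i,1)}, \dots, u_{(i,k-2)}, v_i\}$ and $C_i = \{u_{(i,j)} : u_{(i,j)} \prec v_i, j \in [k-2]\} \cup \{v_{i-1}\}$. The Berge-path is a conflict-free walk from $v_0$ to $v_\ell$ if for each $2 \le i \le \ell$ the edge $e_i$ is disjoint from $\bigcup_{j=1}^{i-1} C_j$; also each one-vertex sequence $(v)$ is a conflict-free walk from $v$ to $v$. The $k$-walk-tree $T(H,v)$ is the $k$-graph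 whose vertices are the conflict-free walks starting at $v$, where $k$ such walks $W_0, W_1, \dots, W_{k-1}$ form an edge whenever there is an edge $e = \{u_0, \dots, u_{k-1}\} \in E(H)$ such that $W_0$ ends at $u_0$ and, for each $i \in [k-1]$, $W_i$ is the walk obtained from $W_0$ by appending $e$ and then $u_i$ (so $W_i$ ends at $u_i$). *)

theory Defs
  imports "HOL-Computational_Algebra.Computational_Algebra"
begin

record 'a hypergraph =
  verts :: "'a set"
  edges :: "'a set set"

definition kgraph :: "nat \<Rightarrow> 'a hypergraph \<Rightarrow> bool" where
  "kgraph k H \<longleftrightarrow> (\<forall>e\<in>edges H. e \<subseteq> verts H \<and> card e = k)"

definition del_vertex :: "'a hypergraph \<Rightarrow> 'a \<Rightarrow> 'a hypergraph" where
  "del_vertex H v = \<lparr>verts = verts H - {v}, edges = {e \<in> edges H. v \<notin> e}\<rparr>"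

definition matching :: "'a hypergraph \<Rightarrow> 'a set set \<Rightarrow> bool" where
  "matching H M \<longleftrightarrow> M \<subseteq> edges H \<and> finite M \<and> pairwise disjnt M"

definition num_matchings :: "'a hypergraph \<Rightarrow> nat \<Rightarrow> nat" where
  "num_matchings H i = card {M. matching H M \<and> card M = i}"

definition matching_poly :: "nat \<Rightarrow> 'a hypergraph \<Rightarrow> real poly" where
  "matching_poly k H =
     (\<Sum>i\<le>card (verts H) div k.
        monom ((-1) ^ i * of_nat (num_matchings H i)) (card (verts H) - k * i))"

text \<open>
  The sequence \<open>(v\<^sub>0, e\<^sub>1, v\<^sub>1, \<dots>, e\<^sub>l, v\<^sub>l)\<close> is encoded as the pair of the list
  \<open>vs = [v\<^sub>0, \<dots>, v\<^sub>l]\<close> and the list \<open>es = [e\<^sub>1, \<dots>, e\<^sub>l]\<close>. Indices are shifted: \<open>es ! i\<close> is the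
  edge with index \<open>i + 1\<close>, joining \<open>vs ! i\<close> to \<open>vs ! Suc i\<close>.
\<close>

type_synonym 'a walk = "'a list \<times> 'a set list"

definition berge_path :: "'a hypergraph \<Rightarrow> 'a walk \<Rightarrow> bool" where
  "berge_path H = (\<lambda>(vs, es).
     length vs = Suc (length es) \<and> distinct vs \<and> distinct es \<and>
     set vs \<subseteq> verts H \<and> set es \<subseteq> edges H \<and>
     (\<forall>i<length es. vs ! i \<in> es ! i \<and> vs ! Suc i \<in> es ! i))"

text \<open>
  \<open>blocked r w i\<close> is the set \<open>C\<close> with index \<open>i + 1\<close>. The relation \<open>r\<close> is the strict ordering:
  \<open>(u, u') \<in> r\<close> means that \<open>u\<close> precedes \<open>u'\<close>.
\<close>

definition blocked :: "'a rel \<Rightarrow> 'a walk \<Rightarrow> nat \<Rightarrow> 'a set" where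
  "blocked r = (\<lambda>(vs, es) i.
     {u \<in> es ! i - {vs ! i, vs ! Suc i}. (u, vs ! Suc i) \<in> r} \<union> {vs ! i})"

definition conflict_free_walk :: "'a rel \<Rightarrow> 'a hypergraph \<Rightarrow> 'a walk \<Rightarrow> bool" where
  "conflict_free_walk r H w \<longleftrightarrow> berge_path H w \<and>
     (\<forall>i<length (snd w). disjnt (snd w ! i) (\<Union>j<i. blocked r w j))"

definition walk_start :: "'a walk \<Rightarrow> 'a" where
  "walk_start w = hd (fst w)"

definition walk_end :: "'a walk \<Rightarrow> 'a" where
  "walk_end w = last (fst w)"

definition extend_walk :: "'a walk \<Rightarrow> 'a set \<Rightarrow> 'a \<Rightarrow> 'a walk" where
  "extend_walk w e u = (fst w @ [u], snd w @ [e])"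

definition trivial_walk :: "'a \<Rightarrow> 'a walk" where
  "trivial_walk v = ([v], [])"

definition walks_from :: "'a rel \<Rightarrow> 'a hypergraph \<Rightarrow> 'a \<Rightarrow> 'a walk set" where
  "walks_from r H v = {w. conflict_free_walk r H w \<and> walk_start w = v}"

definition walk_tree :: "'a rel \<Rightarrow> 'a hypergraph \<Rightarrow> 'a \<Rightarrow> 'a walk hypergraph" where
  "walk_tree r H v =
     \<lparr>verts = walks_from r H v,
      edges = {insert w (extend_walk w e ` (e - {walk_end w})) | w e.
        e \<in> edges H \<and> walk_end w \<in> e \<and> w \<in> walks_from r H v \<and>
        extend_walk w e ` (e - {walk_end w}) \<subseteq> walks_from r H v}\<rparr>"

text \<open>
  The matching polynomial of a finite hypergraph is monic, hence nonzero, and the walk-tree of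
  a finite hypergraph is finite, so no junk values arise from division by zero or from the
  cardinality of infinite sets.
\<close>

lemma num_matchings_0: "num_matchings H 0 = 1"
proof -
  have "{M. matching H M \<and> card M = 0} = {{}}"
    by (auto simp: matching_def pairwise_def)
  then show ?thesis by (simp add: num_matchings_def)
qed

lemma matching_poly_nonzero:
  assumes "k \<ge> 1"
  shows "matching_poly k H \<noteq> 0"
proof -
  let ?n = "card (verts H)"
  have eq: "(?n - k * i = ?n) = (i = 0)" if "i \<in> {..?n div k}" for i
  proof -
    have "k * i \<le> ?n" using that assms
      by (metis atMost_iff div_times_less_eq_dividend mult.commute mult_le_mono2 order_trans)
    moreover have "k * i = 0 \<longleftrightarrow> i = 0" using assms by simp
    ultimately show ?thesis by linarith
  qed
  have "coeff (matching_poly k H) ?n =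
      (\<Sum>i\<le>?n div k. if i = 0 then (-1) ^ i * of_nat (num_matchings H i) else 0)"
    unfolding matching_poly_def coeff_sum coeff_monom
    by (intro sum.cong refl) (simp add: eq)
  also have "\<dots> = 1" by (simp add: num_matchings_0)
  finally show ?thesis by auto
qed

lemma finite_walk_tree:
  assumes "kgraph k H" "finite (verts H)"
  shows "finite (verts (walk_tree r H v))"
proof -
  have E: "finite (edges H)"
    using assms by (auto simp: kgraph_def intro: finite_subset[of _ "Pow (verts H)"])
  have "walks_from r H v \<subseteq>
      {vs. set vs \<subseteq> verts H \<and> distinct vs} \<times> {es. set es \<subseteq> edges H \<and> distinct es}"
    by (auto simp: walks_from_def conflict_free_walk_def berge_path_def)
  moreover have "finite {vs. set vs \<subseteq> verts H \<and> distinct vs}"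
    using finite_subset_distinct[OF assms(2)] by simp
  moreover have "finite {es. set es \<subseteq> edges H \<and> distinct es}"
    using finite_subset_distinct[OF E] by simp
  ultimately show ?thesis
    by (auto simp: walk_tree_def intro: finite_subset)
qed

end

theory Submission
  imports Defs
begin

text \<open>
  Expanding over the edges at a vertex \<open>v\<close> gives
  \<open>m(H) = x m(H - v) - (\<Sum>e\<ni>v. m(H - e))\<close>, so by induction on the number of vertices it suffices
  that the ratios \<open>m(H - e) / m(H - v)\<close> agree with the corresponding ones at the root of the walk-tree.
  Removing the root splits the tree into branches indexed by a first edge \<open>e\<close> and a first vertex
  \<open>u \<in> e - {v}\<close>; this branch is a copy of the walk-tree at \<open>u\<close> of \<open>H\<close> minus \<open>C(e, u)\<close>, where
  \<open>C(e, u)\<close> consists of \<open>v\<close> and the vertices of \<open>e\<close> preceding \<open>u\<close>. By multiplicativity and the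
  induction hypothesis the ratio in the tree is
  \<open>\<Prod>u. m(H - C(e, u) - u) / m(H - C(e, u))\<close>, and since \<open>C(e, u) \<union> {u}\<close> is \<open>C(e, u')\<close> for the next
  vertex \<open>u'\<close> of \<open>e\<close>, this product telescopes to \<open>m(H - e) / m(H - v)\<close>.
\<close>

section \<open>Induced subhypergraphs and the matching polynomial as a sum over matchings\<close>

text \<open>\<open>S\<close> need not lie inside \<open>verts H\<close>, so deleting a set
  \<open>C\<close> is \<open>induced H (- C)\<close>, and successive deletions combine by
  intersecting sets.\<close>

definition induced :: "'a hypergraph \<Rightarrow> 'a set \<Rightarrow> 'a hypergraph" where
  "induced H S = \<lparr>verts = verts H \<inter> S, edges = {e \<in> edges H. e \<subseteq> S}\<rparr>"

lemma verts_induced [simp]: "verts (induced H S) = verts H \<inter> S"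
  and edges_induced [simp]: "edges (induced H S) = {e \<in> edges H. e \<subseteq> S}"
  by (simp_all add: induced_def)

lemma del_vertex_eq_induced: "del_vertex H v = induced H (- {v})"
  by (auto simp: del_vertex_def induced_def)

lemma induced_induced [simp]: "induced (induced H S) S' = induced H (S \<inter> S')"
  by (auto simp: induced_def)

lemma kgraph_induced: "kgraph k H \<Longrightarrow> kgraph k (induced H S)"
  by (auto simp: kgraph_def)

lemma finite_edges: "kgraph k H \<Longrightarrow> finite (verts H) \<Longrightarrow> finite (edges H)"
  by (rule finite_subset[of _ "Pow (verts H)"]) (auto simp: kgraph_def)

lemma finite_matchings: "kgraph k H \<Longrightarrow> finite (verts H) \<Longrightarrow> finite {M. matching H M}"
  by (rule finite_subset[of _ "Pow (edges H)"]) (auto simp: matching_def finite_edges)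

lemma card_Union_matching:
  assumes "kgraph k H" "finite (verts H)" "matching H M"
  shows "card (\<Union> M) = k * card M"
proof -
  have M: "\<And>e. e \<in> M \<Longrightarrow> finite e \<and> card e = k"
    using assms by (auto simp: matching_def kgraph_def intro: finite_subset)
  have "card (\<Union> M) = sum card M"
    using assms(3) M by (intro card_Union_disjoint) (auto simp: matching_def)
  also have "\<dots> = k * card M" using M by simp
  finally show ?thesis .
qed

text \<open>Counting uncovered vertices in the exponent avoids truncated subtraction and makes the
  weight visibly multiplicative over disjoint parts.\<close>

definition matching_term :: "'a hypergraph \<Rightarrow> 'a set set \<Rightarrow> real poly" where
  "matching_term H M = monom ((-1) ^ card M) (card (verts H - \<Union> M))"

text \<open>Matchings are grouped by size. One of size \<open>i\<close> covers exactly
  \<open>k * i\<close> vertices, so for \<open>k \<ge> 1\<close> the bound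
  \<open>card (verts H) div k\<close> loses no matching.\<close>

lemma matching_poly_eq_sum:
  assumes "k \<ge> 1" "kgraph k H" "finite (verts H)"
  shows "matching_poly k H = (\<Sum>M | matching H M. matching_term H M)"
proof -
  let ?n = "card (verts H)"
  have U: "\<Union> M \<subseteq> verts H" if "matching H M" for M
    using that assms(2) by (auto simp: matching_def kgraph_def)
  have weight: "matching_term H M = monom ((-1) ^ card M) (?n - k * card M)"
    if "matching H M" for M
    using card_Union_matching[OF assms(2,3) that] U[OF that] assms(3)
    by (simp add: matching_term_def card_Diff_subset finite_subset)
  have le: "card M \<le> ?n div k" if "matching H M" for M
  proof -
    have "k * card M \<le> ?n"
      using card_Union_matching[OF assms(2,3) that] card_mono[OF assms(3) U[OF that]] by simp
    then show ?thesis using assms(1) by (simp add: less_eq_div_iff_mult_less_eq mult.commute)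
  qed
  have "(\<Sum>M | matching H M. matching_term H M)
      = (\<Sum>i\<le>?n div k. \<Sum>M\<in>{M \<in> {M. matching H M}. card M = i}. matching_term H M)"
    by (rule sum.group[symmetric]) (use finite_matchings[OF assms(2,3)] le in auto)
  also have "\<dots> = (\<Sum>i\<le>?n div k. \<Sum>M | matching H M \<and> card M = i.
      monom ((-1) ^ i) (?n - k * i))"
    by (intro sum.cong) (auto simp: weight)
  also have "\<dots> = matching_poly k H"
    by (simp add: matching_poly_def num_matchings_def of_nat_poly mult_monom mult.commute
        flip: monom_0)
  finally show ?thesis by simp
qed

section \<open>Vertex recurrence, multiplicativity and invariance under injections\<close>

text \<open>A matching that misses \<open>v\<close> is a matching of H - v with one more uncovered
  vertex, whence the factor x. Any other has exactly one edge \<open>e\<close> at \<open>v\<close>;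
  dropping \<open>e\<close> leaves a matching of H - e with the same uncovered vertices and the
  opposite sign.\<close>

lemma matching_poly_vertex:
  assumes "k \<ge> 1" "kgraph k H" "finite (verts H)" "v \<in> verts H"
  shows "matching_poly k H = monom 1 1 * matching_poly k (induced H (- {v}))
    - (\<Sum>e | e \<in> edges H \<and> v \<in> e. matching_poly k (induced H (- e)))"
proof -
  let ?E = "{e \<in> edges H. v \<in> e}"
  let ?A = "{M. matching H M \<and> v \<notin> \<Union> M}"
  let ?B = "\<lambda>e. {M. matching H M \<and> e \<in> M}"
  have fin: "finite {M. matching H M}" by (rule finite_matchings[OF assms(2,3)])
  have induced_sum: "matching_poly k (induced H S)
      = (\<Sum>M | matching (induced H S) M. matching_term (induced H S) M)" for S
    using assms by (intro matching_poly_eq_sum) (auto simp: kgraph_induced)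
  have "(\<Sum>M\<in>?A. matching_term H M)
      = (\<Sum>M | matching (induced H (- {v})) M. monom 1 1 * matching_term (induced H (- {v})) M)"
  proof (rule sum.cong)
    show "?A = {M. matching (induced H (- {v})) M}" by (auto simp: matching_def)
    fix M assume "M \<in> {M. matching (induced H (- {v})) M}"
    then have "verts H - \<Union> M = insert v (verts H \<inter> - {v} - \<Union> M)"
      using assms(4) by (auto simp: matching_def)
    then have "card (verts H - \<Union> M) = Suc (card (verts H \<inter> - {v} - \<Union> M))"
      using assms(3) by (simp add: card_insert_if)
    then show "matching_term H M = monom 1 1 * matching_term (induced H (- {v})) M"
      by (simp add: matching_term_def mult_monom)
  qed
  then have A: "(\<Sum>M\<in>?A. matching_term H M) = monom 1 1 * matching_poly k (induced H (- {v}))"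
    by (simp add: induced_sum sum_distrib_left)
  have B: "(\<Sum>M\<in>?B e. matching_term H M) = - matching_poly k (induced H (- e))"
    if e: "e \<in> edges H" "v \<in> e" for e
  proof -
    have "(\<Sum>M\<in>?B e. matching_term H M)
        = (\<Sum>M | matching (induced H (- e)) M. - matching_term (induced H (- e)) M)"
    proof (rule sum.reindex_bij_witness[where i = "insert e" and j = "\<lambda>M. M - {e}"])
      fix M assume M: "M \<in> ?B e"
      show "insert e (M - {e}) = M" using M by auto
      show N: "M - {e} \<in> {M. matching (induced H (- e)) M}"
        using M by (auto simp: matching_def pairwise_def disjnt_def)
      have "card M = Suc (card (M - {e}))"
        using M card.remove[of M e] by (simp add: matching_def del: card_Diff_insert)
      moreover have "verts H - \<Union> M = verts H \<inter> - e - \<Union> (M - {e})" using M by auto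
      ultimately show "- matching_term (induced H (- e)) (M - {e}) = matching_term H M"
        by (simp add: matching_term_def minus_monom)
    next
      fix M assume M: "M \<in> {M. matching (induced H (- e)) M}"
      show "insert e M - {e} = M" using M e by (auto simp: matching_def)
      show "insert e M \<in> ?B e"
        using M e by (auto simp: matching_def pairwise_insert disjnt_def)
    qed
    then show ?thesis by (simp add: induced_sum sum_negf)
  qed
  have "{M. matching H M} = ?A \<union> (\<Union>e\<in>?E. ?B e)"
    by (auto simp: matching_def)
  then have "matching_poly k H = (\<Sum>M\<in>?A \<union> (\<Union>e\<in>?E. ?B e). matching_term H M)"
    using matching_poly_eq_sum[OF assms(1-3)] by simp
  also have "\<dots> = (\<Sum>M\<in>?A. matching_term H M) + (\<Sum>M\<in>(\<Union>e\<in>?E. ?B e). matching_term H M)"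
    by (rule sum.union_disjoint) (auto intro: finite_subset[OF _ fin] simp: finite_edges[OF assms(2,3)])
  also have "(\<Sum>M\<in>(\<Union>e\<in>?E. ?B e). matching_term H M) = (\<Sum>e\<in>?E. \<Sum>M\<in>?B e. matching_term H M)"
  proof (rule sum.UNION_disjoint)
    \<comment> \<open>Both edges contain \<open>v\<close>, so no matching holds two different
      ones.\<close>
    show "\<forall>e\<in>?E. \<forall>e'\<in>?E. e \<noteq> e' \<longrightarrow> ?B e \<inter> ?B e' = {}"
      unfolding matching_def pairwise_def disjnt_def by blast
  qed (auto intro: finite_subset[OF _ fin] simp: finite_edges[OF assms(2,3)])
  also have "\<dots> = - (\<Sum>e\<in>?E. matching_poly k (induced H (- e)))"
    by (simp add: B sum_negf)
  finally show ?thesis by (simp only: A diff_conv_add_uminus)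
qed

text \<open>A matching amounts to a pair of matchings, one on each side; sizes and numbers of
  uncovered vertices add, so the weights multiply.\<close>

lemma matching_poly_split:
  assumes "k \<ge> 1" "kgraph k H" "finite (verts H)"
    and sep: "\<And>e. e \<in> edges H \<Longrightarrow> e \<subseteq> S \<or> e \<subseteq> - S"
  shows "matching_poly k H = matching_poly k (induced H S) * matching_poly k (induced H (- S))"
proof -
  let ?M = "\<lambda>S. {M. matching (induced H S) M}"
  have induced_sum: "matching_poly k (induced H S)
      = (\<Sum>M\<in>?M S. matching_term (induced H S) M)" for S
    using assms by (intro matching_poly_eq_sum) (auto simp: kgraph_induced)
  \<comment> \<open>An empty edge would lie on both sides, and the two halves could not be recovered
    from their union.\<close>
  have ne: "e \<noteq> {}" if "e \<in> edges H" for e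
    using that assms(1,2) by (auto simp: kgraph_def)
  have "matching_poly k (induced H S) * matching_poly k (induced H (- S))
      = (\<Sum>(M, M')\<in>?M S \<times> ?M (- S). matching_term (induced H S) M * matching_term (induced H (- S)) M')"
    by (simp add: induced_sum sum_product sum.cartesian_product)
  also have "\<dots> = (\<Sum>M | matching H M. matching_term H M)"
  proof (rule sum.reindex_bij_witness[where j = "\<lambda>(M, M'). M \<union> M'"
        and i = "\<lambda>M. ({e \<in> M. e \<subseteq> S}, {e \<in> M. e \<subseteq> - S})"])
    fix p assume "p \<in> ?M S \<times> ?M (- S)"
    then obtain M M' where p: "p = (M, M')" and M: "matching (induced H S) M"
      and M': "matching (induced H (- S)) M'" by auto
    have S: "\<And>e. e \<in> M \<Longrightarrow> e \<subseteq> S" "\<And>e. e \<in> M' \<Longrightarrow> e \<subseteq> - S"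
      and E: "M \<subseteq> edges H" "M' \<subseteq> edges H" and f: "finite M" "finite M'"
      using M M' by (auto simp: matching_def)
    have disj: "disjnt e e'" if "e \<in> M" "e' \<in> M'" for e e'
      using S that by (fastforce simp: disjnt_def)
    have MM: "M \<inter> M' = {}" using disj E ne by (fastforce simp: disjnt_def)
    have "{e \<in> M \<union> M'. e \<subseteq> S} = M" "{e \<in> M \<union> M'. e \<subseteq> - S} = M'"
      using S E ne by fastforce+
    then show "(\<lambda>M. ({e \<in> M. e \<subseteq> S}, {e \<in> M. e \<subseteq> - S})) ((\<lambda>(M, M'). M \<union> M') p) = p"
      by (simp add: p)
    have "pairwise disjnt (M \<union> M')"
      using M M' disj by (auto simp: matching_def pairwise_def disjnt_sym)
    then show "(\<lambda>(M, M'). M \<union> M') p \<in> {M. matching H M}"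
      using E f by (simp add: p matching_def)
    have "verts H - \<Union> (M \<union> M')
        = (verts H \<inter> S - \<Union> M) \<union> (verts H \<inter> - S - \<Union> M')"
      using S by auto
    then have "card (verts H - \<Union> (M \<union> M'))
        = card ((verts H \<inter> S - \<Union> M) \<union> (verts H \<inter> - S - \<Union> M'))" by (rule arg_cong)
    also have "\<dots> = card (verts H \<inter> S - \<Union> M) + card (verts H \<inter> - S - \<Union> M')"
      using assms(3) by (intro card_Un_disjoint) auto
    finally show "matching_term H ((\<lambda>(M, M'). M \<union> M') p)
        = (case p of (M, M') \<Rightarrow> matching_term (induced H S) M * matching_term (induced H (- S)) M')"
      by (simp add: p matching_term_def mult_monom card_Un_disjoint[OF f MM] power_add)
  next
    fix M assume M: "M \<in> {M. matching H M}"
    show "(\<lambda>(M, M'). M \<union> M') ({e \<in> M. e \<subseteq> S}, {e \<in> M. e \<subseteq> - S}) = M"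
      using M sep by (auto simp: matching_def)
    show "({e \<in> M. e \<subseteq> S}, {e \<in> M. e \<subseteq> - S}) \<in> ?M S \<times> ?M (- S)"
      using M by (auto simp: matching_def pairwise_def)
  qed
  finally show ?thesis using matching_poly_eq_sum[OF assms(1-3)] by simp
qed

lemma matching_poly_empty:
  assumes "k \<ge> 1" "kgraph k H" "verts H = {}"
  shows "matching_poly k H = 1"
proof -
  have "edges H = {}" using assms by (force simp: kgraph_def)
  then have "{M. matching H M} = {{}}" by (auto simp: matching_def)
  then show ?thesis
    using assms by (subst matching_poly_eq_sum) (auto simp: matching_term_def)
qed

text \<open>A colouring constant on edges makes every class a union of components, and the classes
  are split off one by one. A colour that does not occur contributes the factor 1. The colour used
  later is the first step of a walk.\<close>

lemma matching_poly_colour_classes: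
  assumes "k \<ge> 1" "finite I" "kgraph k H" "finite (verts H)" "c ` verts H \<subseteq> I"
    and mono: "\<And>e x y. \<lbrakk>e \<in> edges H; x \<in> e; y \<in> e\<rbrakk> \<Longrightarrow> c x = c y"
  shows "matching_poly k H = (\<Prod>i\<in>I. matching_poly k (induced H {x. c x = i}))"
  using assms(2-6)
proof (induction I arbitrary: H rule: finite_induct)
  case empty
  then show ?case using matching_poly_empty[OF assms(1)] by simp
next
  case (insert i I)
  let ?S = "{x. c x = i}"
  have mono: "\<And>e x y. \<lbrakk>e \<in> edges H; x \<in> e; y \<in> e\<rbrakk> \<Longrightarrow> c x = c y" by fact
  have "matching_poly k H = matching_poly k (induced H ?S) * matching_poly k (induced H (- ?S))"
  proof (rule matching_poly_split[OF assms(1) insert.prems(1,2)])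
    fix e assume "e \<in> edges H"
    then show "e \<subseteq> ?S \<or> e \<subseteq> - ?S" using mono[of e] by blast
  qed
  also have "matching_poly k (induced H (- ?S))
      = (\<Prod>j\<in>I. matching_poly k (induced (induced H (- ?S)) {x. c x = j}))"
  proof (rule insert.IH)
    show "kgraph k (induced H (- ?S))" by (rule kgraph_induced) fact
    show "c ` verts (induced H (- ?S)) \<subseteq> I" using insert.prems(3) by auto
    show "c x = c y" if "e \<in> edges (induced H (- ?S))" "x \<in> e" "y \<in> e" for e x y
      using that mono[of e x y] by simp
  qed (use insert.prems(2) in simp)
  also have "\<dots> = (\<Prod>j\<in>I. matching_poly k (induced H {x. c x = j}))"
  proof (rule prod.cong)
    fix j assume "j \<in> I"
    then have "- ?S \<inter> {x. c x = j} = {x. c x = j}" using insert.hyps by auto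
    then show "matching_poly k (induced (induced H (- ?S)) {x. c x = j})
        = matching_poly k (induced H {x. c x = j})" by simp
  qed simp
  finally show ?case using insert.hyps by simp
qed

text \<open>Meant for \<open>prepend\<close>, which copies a smaller walk-tree into a branch of a
  larger one. An injection of vertices acts injectively on edges and on matchings and keeps the
  weight of each matching.\<close>

lemma matching_poly_image:
  assumes "k \<ge> 1" "kgraph k H" "finite (verts H)" "inj f"
  shows "matching_poly k \<lparr>verts = f ` verts H, edges = (`) f ` edges H\<rparr> = matching_poly k H"
proof -
  let ?G = "\<lparr>verts = f ` verts H, edges = (`) f ` edges H\<rparr>"
  have inj2: "inj ((`) f)" by (rule injI) (simp add: inj_image_eq_iff[OF assms(4)])
  have "kgraph k ?G"
    using assms(2,4) by (auto simp: kgraph_def card_image inj_on_subset)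
  then have "matching_poly k ?G = (\<Sum>M | matching ?G M. matching_term ?G M)"
    using assms by (intro matching_poly_eq_sum) auto
  also have "{M. matching ?G M} = (`) ((`) f) ` {M. matching H M}"
  proof (intro equalityI subsetI)
    fix M assume "M \<in> {M. matching ?G M}"
    then have M: "matching ?G M" by simp
    then obtain N where N: "M = (`) f ` N" "N \<subseteq> edges H"
      by (auto simp: matching_def subset_image_iff)
    have "disjnt e e'" if "e \<in> N" "e' \<in> N" "e \<noteq> e'" for e e'
    proof -
      have "f ` e \<in> M" "f ` e' \<in> M" "f ` e \<noteq> f ` e'"
        using that N assms(4) by (auto simp: inj_image_eq_iff)
      then have "disjnt (f ` e) (f ` e')" using M by (auto simp: matching_def pairwise_def)
      then show ?thesis by (auto simp: disjnt_def)
    qed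
    moreover have "finite N"
      using M N inj2 by (auto simp: matching_def intro: finite_imageD inj_on_subset)
    ultimately have "matching H N" using N by (auto simp: matching_def pairwise_def)
    then show "M \<in> (`) ((`) f) ` {M. matching H M}" using N by auto
  next
    fix M assume "M \<in> (`) ((`) f) ` {M. matching H M}"
    then obtain N where N: "matching H N" "M = (`) f ` N" by auto
    have "disjnt (f ` e) (f ` e')" if "e \<in> N" "e' \<in> N" "f ` e \<noteq> f ` e'" for e e'
    proof -
      have "e \<noteq> e'" using that(3) by blast
      then have "disjnt e e'" using that(1,2) N(1) by (simp add: matching_def pairwise_def)
      then show ?thesis using assms(4) by (auto simp: disjnt_def inj_def)
    qed
    then show "M \<in> {M. matching ?G M}"
      using N by (auto simp: matching_def pairwise_def)
  qed
  also have "(\<Sum>M\<in>(`) ((`) f) ` {M. matching H M}. matching_term ?G M)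
      = (\<Sum>M | matching H M. matching_term ?G ((`) f ` M))"
    by (subst sum.reindex) (use inj2 in \<open>auto simp: inj_on_def inj_image_eq_iff\<close>)
  also have "\<dots> = (\<Sum>M | matching H M. matching_term H M)"
  proof (rule sum.cong)
    fix M
    have "f ` verts H - \<Union> ((`) f ` M) = f ` (verts H - \<Union> M)"
      by (simp add: image_set_diff[OF assms(4)] image_Union)
    then show "matching_term ?G ((`) f ` M) = matching_term H M"
      using assms(4) inj2 by (simp add: matching_term_def card_image inj_on_subset)
  qed simp
  finally show ?thesis using matching_poly_eq_sum[OF assms(1-3)] by simp
qed

section \<open>Telescoping along a finite linear order\<close>

lemma finite_strict_linear_order_max:
  assumes "finite S" "S \<noteq> {}" "strict_linear_order_on S r"
  shows "\<exists>m\<in>S. \<forall>x\<in>S - {m}. (x, m) \<in> r"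
  using assms
proof (induction S rule: finite_ne_induct)
  case (singleton x)
  then show ?case by simp
next
  case (insert x S)
  then have "strict_linear_order_on S r"
    by (auto simp: strict_linear_order_on_def total_on_def)
  then obtain m where m: "m \<in> S" "\<forall>y\<in>S - {m}. (y, m) \<in> r" using insert.IH by auto
  have "(x, m) \<in> r \<or> (m, x) \<in> r" "trans r"
    using insert m by (auto simp: strict_linear_order_on_def total_on_def)
  then show ?case using m by (auto dest: transD)
qed

text \<open>Both sides are the product of \<open>g\<close> over all initial segments of
  \<open>U\<close>, from \<open>{}\<close> to \<open>U\<close>: the product on the left omits only
  \<open>{}\<close>, the one on the right only \<open>U\<close>. This form of telescoping needs no
  division. The induction removes the largest element.\<close>

lemma prod_telescope_order:
  fixes g :: "'a set \<Rightarrow> 'b :: comm_monoid_mult"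
  assumes "finite U" "strict_linear_order_on U r"
  shows "g {} * (\<Prod>u\<in>U. g (insert u {u' \<in> U. (u', u) \<in> r}))
    = g U * (\<Prod>u\<in>U. g {u' \<in> U. (u', u) \<in> r})"
  using assms
proof (induction "card U" arbitrary: U)
  case 0
  then show ?case by simp
next
  case (Suc n)
  then have "U \<noteq> {}" by auto
  then obtain m where m: "m \<in> U" "\<forall>x\<in>U - {m}. (x, m) \<in> r"
    using finite_strict_linear_order_max Suc.prems by metis
  let ?W = "U - {m}"
  have r: "trans r" "irrefl r" using Suc.prems by (auto simp: strict_linear_order_on_def)
  \<comment> \<open>\<open>m\<close> is above \<open>u\<close>, hence by transitivity and
    irreflexivity not below it, so removing \<open>m\<close> leaves the segment below
    \<open>u\<close> unchanged.\<close>
  have le: "{u' \<in> U. (u', u) \<in> r} = {u' \<in> ?W. (u', u) \<in> r}" if "u \<in> ?W" for u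
    using that m r by (auto simp: irrefl_def dest: transD)
  have lm: "{u' \<in> U. (u', m) \<in> r} = ?W" using m r by (auto simp: irrefl_def)
  have IH: "g {} * (\<Prod>u\<in>?W. g (insert u {u' \<in> ?W. (u', u) \<in> r}))
      = g ?W * (\<Prod>u\<in>?W. g {u' \<in> ?W. (u', u) \<in> r})"
    using Suc m by (intro Suc.hyps) (auto simp: strict_linear_order_on_def total_on_def)
  have "g {} * (\<Prod>u\<in>U. g (insert u {u' \<in> U. (u', u) \<in> r}))
      = g (insert m ?W) * (g {} * (\<Prod>u\<in>?W. g (insert u {u' \<in> U. (u', u) \<in> r})))"
    using Suc.prems(1) m(1) lm by (subst prod.remove[of _ m]) (auto simp: mult_ac)
  also have "(\<Prod>u\<in>?W. g (insert u {u' \<in> U. (u', u) \<in> r}))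
      = (\<Prod>u\<in>?W. g (insert u {u' \<in> ?W. (u', u) \<in> r}))"
    by (intro prod.cong refl) (simp only: le)
  also note IH
  also have "(\<Prod>u\<in>?W. g {u' \<in> ?W. (u', u) \<in> r}) = (\<Prod>u\<in>?W. g {u' \<in> U. (u', u) \<in> r})"
    by (intro prod.cong refl) (simp only: le)
  also have "g (insert m ?W) * (g ?W * (\<Prod>u\<in>?W. g {u' \<in> U. (u', u) \<in> r}))
      = g U * (\<Prod>u\<in>U. g {u' \<in> U. (u', u) \<in> r})"
    using Suc.prems(1) m(1) lm by (subst prod.remove[of U m]) (auto simp: insert_absorb)
  finally show ?case .
qed

section \<open>Decomposing a walk by its first step\<close>

definition prepend :: "'a \<Rightarrow> 'a set \<Rightarrow> 'a walk \<Rightarrow> 'a walk" where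
  "prepend v e w = (v # fst w, e # snd w)"

lemma inj_prepend: "inj (prepend v e)"
  by (auto simp: inj_def prepend_def prod_eq_iff)

text \<open>This is C(e, u), the set \<open>blocked\<close> at index 0 for a walk beginning with
  \<open>v\<close>, \<open>e\<close>, \<open>u\<close>. There \<open>u\<close> is excluded
  explicitly, here by irreflexivity of \<open>r\<close>.\<close>

definition earlier :: "'a rel \<Rightarrow> 'a \<Rightarrow> 'a set \<Rightarrow> 'a \<Rightarrow> 'a set" where
  "earlier r v e u = insert v {u' \<in> e - {v}. (u', u) \<in> r}"

lemma walk_simps:
  assumes "w \<in> walks_from r H v"
  shows "fst w \<noteq> []" "hd (fst w) = v" "walk_end w \<in> verts H"
proof -
  have "length (fst w) = Suc (length (snd w))" and hd: "hd (fst w) = v" and V: "set (fst w) \<subseteq> verts H"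
    using assms
    by (auto simp: walks_from_def conflict_free_walk_def berge_path_def walk_start_def)
  then show ne: "fst w \<noteq> []" by auto
  show "hd (fst w) = v" by (fact hd)
  show "walk_end w \<in> verts H" using V last_in_set[OF ne] by (auto simp: walk_end_def)
qed

lemma blocked_Cons_0:
  "irrefl r \<Longrightarrow> vs \<noteq> [] \<Longrightarrow> blocked r (v # vs, e # es) 0 = earlier r v e (hd vs)"
  by (auto simp: blocked_def earlier_def irrefl_def hd_conv_nth)

lemma blocked_Cons_Suc: "blocked r (v # vs, e # es) (Suc i) = blocked r (vs, es) i"
  by (simp add: blocked_def)

text \<open>The first edge of a walk is unconstrained. The first blocked set is C(e, u) and the
  later ones are those of \<open>w\<close>, so the longer walk is conflict-free exactly if
  \<open>w\<close> is and all edges of \<open>w\<close> avoid C(e, u), that is, if \<open>w\<close>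
  is conflict-free after deleting C(e, u).\<close>

lemma prepend_in_walks_from:
  assumes "kgraph k H" "irrefl r" "e \<in> edges H" "v \<in> e" "u \<in> e - {v}"
  shows "prepend v e w \<in> walks_from r H v \<and> fst w \<noteq> [] \<and> hd (fst w) = u
    \<longleftrightarrow> w \<in> walks_from r (induced H (- earlier r v e u)) u"
proof (cases "fst w = []")
  case True
  then show ?thesis using walk_simps(1) by metis
next
  case False
  obtain vs es where w: "w = (vs, es)" by (cases w)
  let ?C = "earlier r v e u"
  have ne: "vs \<noteq> []" using False w by simp
  have v: "v \<in> verts H" "e \<subseteq> verts H" using assms by (auto simp: kgraph_def)
  have vC: "v \<in> ?C" "u \<notin> ?C" using assms by (auto simp: earlier_def irrefl_def)
  show ?thesis
  proof (cases "hd vs = u \<and> length vs = Suc (length es)")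
    case False
    then show ?thesis
      using ne
      by (auto simp: w prepend_def walks_from_def conflict_free_walk_def berge_path_def walk_start_def)
  next
    case True
    have b0: "blocked r (v # vs, e # es) 0 = ?C" using blocked_Cons_0 assms(2) ne True by metis
    \<comment> \<open>Index 0 is split off; the other blocked sets are those of \<open>w\<close>,
      shifted by one.\<close>
    have U: "(\<Union>j<Suc i. blocked r (v # vs, e # es) j) = ?C \<union> (\<Union>j<i. blocked r (vs, es) j)" for i
      unfolding lessThan_Suc_eq_insert_0 by (auto simp: b0 blocked_Cons_Suc)
    have cf: "(\<forall>i<Suc (length es). disjnt ((e # es) ! i) (\<Union>j<i. blocked r (v # vs, e # es) j))
      \<longleftrightarrow> (\<forall>i<length es. disjnt (es ! i) ?C) \<and> (\<forall>i<length es. disjnt (es ! i) (\<Union>j<i. blocked r (vs, es) j))"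
      unfolding All_less_Suc2 nth_Cons_0 nth_Cons_Suc U disjnt_Un2 by auto
    have es: "(\<forall>i<length es. disjnt (es ! i) ?C) \<longleftrightarrow> (\<forall>e'\<in>set es. disjnt e' ?C)"
      by (metis in_set_conv_nth)
    have inc: "(\<forall>i<Suc (length es). (v # vs) ! i \<in> (e # es) ! i \<and> (v # vs) ! Suc i \<in> (e # es) ! i)
      \<longleftrightarrow> (\<forall>i<length es. vs ! i \<in> es ! i \<and> vs ! Suc i \<in> es ! i)"
      using True assms(4,5) ne by (auto simp: All_less_Suc2 hd_conv_nth)
    \<comment> \<open>Avoidance by the edges gives avoidance by the vertices: each vertex after the
      first lies in the edge leading to it, and the first one is \<open>u\<close>, which is outside
      \<open>?C\<close>.\<close>
    have vs: "\<forall>x\<in>set vs. x \<notin> ?C"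
      if "\<forall>e'\<in>set es. disjnt e' ?C" "\<forall>i<length es. vs ! Suc i \<in> es ! i"
    proof
      fix x assume "x \<in> set vs"
      then obtain i where i: "i < length vs" "x = vs ! i" by (auto simp: in_set_conv_nth)
      show "x \<notin> ?C"
      proof (cases i)
        case 0
        then show ?thesis using i True vC ne by (simp add: hd_conv_nth)
      next
        case (Suc j)
        then have "x \<in> es ! j" "es ! j \<in> set es" using i True that(2) by auto
        then show ?thesis using that(1) by (auto simp: disjnt_def)
      qed
    qed
    have 1: "prepend v e w \<in> walks_from r H v \<longleftrightarrow>
        distinct vs \<and> v \<notin> set vs \<and> distinct es \<and> e \<notin> set es \<and> set vs \<subseteq> verts H \<and> set es \<subseteq> edges H
        \<and> (\<forall>i<length es. vs ! i \<in> es ! i \<and> vs ! Suc i \<in> es ! i)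
        \<and> (\<forall>e'\<in>set es. disjnt e' ?C) \<and> (\<forall>i<length es. disjnt (es ! i) (\<Union>j<i. blocked r (vs, es) j))"
      unfolding walks_from_def conflict_free_walk_def berge_path_def walk_start_def w prepend_def
        mem_Collect_eq case_prod_conv fst_conv snd_conv length_Cons cf es inc
      using True v(1) assms(3) by auto
    have 2: "w \<in> walks_from r (induced H (- ?C)) u \<longleftrightarrow>
        distinct vs \<and> distinct es \<and> set vs \<subseteq> verts H - ?C \<and> set es \<subseteq> edges H
        \<and> (\<forall>i<length es. vs ! i \<in> es ! i \<and> vs ! Suc i \<in> es ! i)
        \<and> (\<forall>e'\<in>set es. disjnt e' ?C) \<and> (\<forall>i<length es. disjnt (es ! i) (\<Union>j<i. blocked r (vs, es) j))"
      using True
      by (auto simp: walks_from_def conflict_free_walk_def berge_path_def walk_start_def w disjnt_def)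
    \<comment> \<open>That \<open>v\<close> and \<open>e\<close> do not recur in \<open>w\<close> is
      automatic in the smaller hypergraph, as \<open>v\<close> lies both in \<open>?C\<close> and in
      \<open>e\<close>.\<close>
    show ?thesis
      unfolding 1 2 using True ne vs vC assms(4) by (auto simp: w disjnt_def)
  qed
qed

lemma trivial_walk_in_walks_from: "v \<in> verts H \<Longrightarrow> trivial_walk v \<in> walks_from r H v"
  by (simp add: trivial_walk_def walks_from_def conflict_free_walk_def berge_path_def walk_start_def)

lemma walks_from_cases:
  assumes "kgraph k H" "irrefl r" "w \<in> walks_from r H v"
  obtains "w = trivial_walk v"
  | e u w' where "e \<in> edges H" "v \<in> e" "u \<in> e - {v}" "w = prepend v e w'"
      "w' \<in> walks_from r (induced H (- earlier r v e u)) u"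
proof (cases "snd w")
  case Nil
  then have "w = trivial_walk v"
    using assms(3) walk_simps(1,2)[OF assms(3)]
    by (cases w) (auto simp: trivial_walk_def walks_from_def conflict_free_walk_def berge_path_def length_Suc_conv)
  then show thesis by (rule that(1))
next
  case (Cons e es)
  then obtain u vs where w: "w = (v # u # vs, e # es)"
    using assms(3) walk_simps(1,2)[OF assms(3)]
    by (cases w) (auto simp: walks_from_def conflict_free_walk_def berge_path_def length_Suc_conv)
  have eu: "e \<in> edges H" "v \<in> e" "u \<in> e - {v}"
    using assms(3) by (auto simp: w walks_from_def conflict_free_walk_def berge_path_def All_less_Suc2)
  have "w = prepend v e (u # vs, es)" by (simp add: w prepend_def)
  moreover from this have "(u # vs, es) \<in> walks_from r (induced H (- earlier r v e u)) u"
    using prepend_in_walks_from[OF assms(1,2) eu, of "(u # vs, es)"] assms(3) by simp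
  ultimately show thesis using that(2) eu by blast
qed

section \<open>Edges of the walk-tree\<close>

text \<open>The edge that the parent \<open>w\<close> and \<open>e\<close> would create; it is
  present in the tree only if all its members are conflict-free walks. As \<open>w\<close> is a
  member, a single inclusion also covers the parent.\<close>

definition tree_edge :: "'a walk \<Rightarrow> 'a set \<Rightarrow> 'a walk set" where
  "tree_edge w e = insert w (extend_walk w e ` (e - {walk_end w}))"

lemma verts_walk_tree: "verts (walk_tree r H v) = walks_from r H v"
  and edges_walk_tree: "edges (walk_tree r H v)
    = {tree_edge w e | w e. e \<in> edges H \<and> walk_end w \<in> e \<and> tree_edge w e \<subseteq> walks_from r H v}"
  by (auto simp: walk_tree_def tree_edge_def)

lemma walk_end_extend_walk [simp]: "walk_end (extend_walk w e u) = u"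
  by (simp add: walk_end_def extend_walk_def)

text \<open>The end points recover the underlying edge of \<open>H\<close>. This makes the tree
  edges at a fixed parent distinct and tells which deleted vertices an edge avoids.\<close>

lemma walk_end_tree_edge: "walk_end w \<in> e \<Longrightarrow> walk_end ` tree_edge w e = e"
  by (force simp: tree_edge_def)

text \<open>The extensions of \<open>w\<close> differ from each other in their last vertex and from
  \<open>w\<close> in length, so a tree edge has 1 + (k - 1) members.\<close>

lemma kgraph_walk_tree:
  assumes "kgraph k H" "finite (verts H)"
  shows "kgraph k (walk_tree r H v)"
proof -
  have "card (tree_edge w e) = k" if e: "e \<in> edges H" "walk_end w \<in> e" for w e
  proof -
    have fin: "finite e" and k: "card e = k"
      using assms e(1) by (auto simp: kgraph_def intro: finite_subset)
    have "inj_on (extend_walk w e) (e - {walk_end w})" "w \<notin> range (extend_walk w e)"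
      by (auto simp: inj_on_def extend_walk_def prod_eq_iff)
    then have "card (tree_edge w e) = Suc (card (e - {walk_end w}))"
      using fin by (auto simp: tree_edge_def card_image card_insert_if)
    also have "\<dots> = k" using card.remove[OF fin e(2)] k by simp
    finally show ?thesis .
  qed
  then show ?thesis by (auto simp: kgraph_def verts_walk_tree edges_walk_tree)
qed

lemma extend_prepend: "extend_walk (prepend v e w) e' x = prepend v e (extend_walk w e' x)"
  by (simp add: extend_walk_def prepend_def)

lemma walk_end_prepend: "fst w \<noteq> [] \<Longrightarrow> walk_end (prepend v e w) = walk_end w"
  by (simp add: walk_end_def prepend_def)

lemma tree_edge_prepend:
  "fst w \<noteq> [] \<Longrightarrow> tree_edge (prepend v e w) e' = prepend v e ` tree_edge w e'"
  by (auto simp: tree_edge_def extend_prepend walk_end_prepend)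

lemma tree_edge_trivial:
  "tree_edge (trivial_walk v) e
    = insert (trivial_walk v) ((\<lambda>u. prepend v e (trivial_walk u)) ` (e - {v}))"
  by (auto simp: tree_edge_def extend_walk_def trivial_walk_def walk_end_def prepend_def)

lemma prepend_neq_trivial [simp]: "prepend v e w \<noteq> trivial_walk u"
  by (simp add: prepend_def trivial_walk_def)

section \<open>Branches of the walk-tree at its root\<close>

text \<open>
  On a trivial walk the value of \<open>first_step\<close> is junk, which is why \<open>branch\<close> excludes the root.
\<close>

definition first_step :: "'a walk \<Rightarrow> 'a set \<times> 'a" where
  "first_step w = (hd (snd w), fst w ! 1)"

lemma first_step_prepend: "fst w \<noteq> [] \<Longrightarrow> first_step (prepend v e w) = (e, hd (fst w))"
  by (simp add: first_step_def prepend_def hd_conv_nth)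

definition branch :: "'a \<Rightarrow> 'a set \<times> 'a \<Rightarrow> 'a walk set" where
  "branch v p = {w. w \<noteq> trivial_walk v \<and> first_step w = p}"

lemma induced_UNIV [simp]: "induced H UNIV = H"
  by (simp add: induced_def)

lemma fst_tree_edge: "fst w \<noteq> [] \<Longrightarrow> w' \<in> tree_edge w e \<Longrightarrow> fst w' \<noteq> [] \<and> hd (fst w') = hd (fst w)"
  by (auto simp: tree_edge_def extend_walk_def)

text \<open>The branch is a copy of the smaller tree even after removing a set \<open>A\<close> of
  its walks. Two cases are needed: \<open>A\<close> empty, when only the root of the whole tree is
  deleted, and \<open>A\<close> the root of the smaller tree, when an edge at the root is
  deleted.\<close>

lemma induced_branch:
  assumes "kgraph k H" "irrefl r" "e \<in> edges H" "v \<in> e" "u \<in> e - {v}"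
  defines "T \<equiv> walk_tree r H v"
    and "T' \<equiv> walk_tree r (induced H (- earlier r v e u)) u"
  shows "induced T (branch v (e, u) - prepend v e ` A)
    = \<lparr>verts = prepend v e ` verts (induced T' (- A)),
       edges = (`) (prepend v e) ` edges (induced T' (- A))\<rparr>"
proof -
  let ?C = "earlier r v e u"
  let ?P = "prepend v e"
  let ?W = "walks_from r H v" and ?W' = "walks_from r (induced H (- ?C)) u"
  have inj: "inj ?P" by (rule inj_prepend)
  have W: "?W \<inter> branch v (e, u) = ?P ` ?W'"
  proof (intro equalityI subsetI)
    fix w assume w: "w \<in> ?W \<inter> branch v (e, u)"
    then have "w \<in> ?W" by simp
    from assms(1,2) this show "w \<in> ?P ` ?W'"
    proof (cases rule: walks_from_cases)
      case 1
      then show ?thesis using w by (simp add: branch_def)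
    next
      case (2 e' u' w')
      then have "(e', u') = (e, u)"
        using w walk_simps(1,2)[OF 2(5)] by (simp add: branch_def first_step_prepend)
      then show ?thesis using 2 by auto
    qed
  next
    fix w assume "w \<in> ?P ` ?W'"
    then obtain w' where w': "w = ?P w'" "w' \<in> ?W'" by auto
    then show "w \<in> ?W \<inter> branch v (e, u)"
      using prepend_in_walks_from[OF assms(1-5), of w']
      by (auto simp: branch_def first_step_prepend)
  qed
  have E: "tree_edge w f \<in> (`) ?P ` edges (induced T' (- A))"
    if f: "f \<in> edges H" "walk_end w \<in> f" "tree_edge w f \<subseteq> ?W"
      "tree_edge w f \<subseteq> branch v (e, u) - ?P ` A" for w f
  proof -
    have sub: "tree_edge w f \<subseteq> ?P ` ?W'" using f(3,4) W by blast
    moreover have "w \<in> tree_edge w f" by (simp add: tree_edge_def)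
    ultimately obtain w' where w': "w = ?P w'" "w' \<in> ?W'" by blast
    have ne: "fst w' \<noteq> []" using walk_simps(1)[OF w'(2)] .
    have eq: "tree_edge w f = ?P ` tree_edge w' f" using tree_edge_prepend[OF ne] w'(1) by simp
    have end': "walk_end w' \<in> f" using f(2) walk_end_prepend[OF ne] w'(1) by simp
    have sub': "tree_edge w' f \<subseteq> ?W'"
      using sub by (simp add: eq inj_image_subset_iff[OF inj])
    \<comment> \<open>The members of the tree edge end exactly in the vertices of \<open>f\<close>
      and are walks avoiding \<open>?C\<close>, so \<open>f\<close> is still an edge after
      \<open>?C\<close> is deleted.\<close>
    have "f = walk_end ` tree_edge w' f" using walk_end_tree_edge[OF end'] by simp
    also have "\<dots> \<subseteq> verts (induced H (- ?C))"
      by (intro image_subsetI walk_simps(3)) (rule subsetD[OF sub'])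
    finally have "f \<in> edges (induced H (- ?C))" using f(1) by auto
    moreover have "tree_edge w' f \<subseteq> - A" using f(4) eq by auto
    ultimately have "tree_edge w' f \<in> edges (induced T' (- A))"
      using sub' end' unfolding T'_def edges_induced[of "walk_tree _ _ _"] edges_walk_tree by blast
    then show ?thesis unfolding eq by (rule imageI)
  qed
  have E': "?P ` F \<in> edges (induced T (branch v (e, u) - ?P ` A))"
    if F: "F \<in> edges (induced T' (- A))" for F
  proof -
    obtain w f where wf: "F = tree_edge w f" "f \<in> edges H" "walk_end w \<in> f"
        "tree_edge w f \<subseteq> ?W'" "F \<subseteq> - A"
      using F by (auto simp: T'_def edges_walk_tree)
    have ne: "fst w \<noteq> []" using wf(4) walk_simps(1) by (fastforce simp: tree_edge_def)
    have eq: "?P ` F = tree_edge (?P w) f" using tree_edge_prepend[OF ne] wf(1) by simp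
    have sub: "?P ` F \<subseteq> ?W \<inter> branch v (e, u)" unfolding W using wf by auto
    have "walk_end (?P w) \<in> f" using wf(3) walk_end_prepend[OF ne] by simp
    with sub have T: "?P ` F \<in> edges T"
      using wf(2) unfolding T_def edges_walk_tree eq by blast
    have "F \<inter> A = {}" using wf(5) by blast
    then have "?P ` F \<inter> ?P ` A = {}" by (simp flip: image_Int[OF inj])
    with sub T show ?thesis by auto
  qed
  have "?W \<inter> (branch v (e, u) - ?P ` A) = ?P ` ?W' - ?P ` A" using W by blast
  also have "\<dots> = ?P ` (?W' \<inter> - A)" by (simp only: image_set_diff[OF inj] flip: Diff_eq)
  finally have "verts (induced T (branch v (e, u) - ?P ` A)) = ?P ` verts (induced T' (- A))"
    by (simp add: T_def T'_def verts_walk_tree)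
  moreover have "edges (induced T (branch v (e, u) - ?P ` A)) = (`) ?P ` edges (induced T' (- A))"
  proof (intro equalityI subsetI)
    fix F assume "F \<in> edges (induced T (branch v (e, u) - ?P ` A))"
    then show "F \<in> (`) ?P ` edges (induced T' (- A))"
      using E unfolding T_def edges_induced[of "walk_tree r H v"] edges_walk_tree by blast
  qed (use E' in blast)
  ultimately show ?thesis by (simp add: induced_def)
qed

lemma matching_poly_branch:
  assumes "k \<ge> 1" "kgraph k H" "finite (verts H)" "irrefl r"
    and "e \<in> edges H" "v \<in> e" "u \<in> e - {v}"
  shows "matching_poly k (induced (walk_tree r H v) (branch v (e, u) - prepend v e ` A))
    = matching_poly k (induced (walk_tree r (induced H (- earlier r v e u)) u) (- A))"
proof -
  let ?T' = "induced (walk_tree r (induced H (- earlier r v e u)) u) (- A)"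
  have "finite (verts ?T')"
    using finite_walk_tree[OF kgraph_induced[OF assms(2)]] assms(3) by simp
  moreover have "kgraph k ?T'"
    using assms(2,3) by (intro kgraph_induced kgraph_walk_tree) auto
  ultimately show ?thesis
    unfolding induced_branch[OF assms(2,4-7)]
    using assms(1) by (intro matching_poly_image inj_prepend)
qed

text \<open>Every edge at \<open>v\<close> yields a tree edge, since \<open>u\<close> is not in C(e,
  u) and hence a single step is always conflict-free. Conversely the root is no extension of another
  walk, so it must be the parent in any tree edge containing it.\<close>

lemma edges_walk_tree_root:
  assumes "kgraph k H" "irrefl r" "v \<in> verts H"
  shows "{E \<in> edges (walk_tree r H v). trivial_walk v \<in> E}
    = tree_edge (trivial_walk v) ` {e \<in> edges H. v \<in> e}"
proof (intro equalityI subsetI)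
  fix E assume "E \<in> {E \<in> edges (walk_tree r H v). trivial_walk v \<in> E}"
  then obtain w e where E: "E = tree_edge w e" "e \<in> edges H" "walk_end w \<in> e" "trivial_walk v \<in> E"
    by (auto simp: edges_walk_tree)
  then have "w = trivial_walk v" by (auto simp: tree_edge_def extend_walk_def trivial_walk_def)
  then show "E \<in> tree_edge (trivial_walk v) ` {e \<in> edges H. v \<in> e}"
    using E by (auto simp: walk_end_def trivial_walk_def)
next
  fix E assume "E \<in> tree_edge (trivial_walk v) ` {e \<in> edges H. v \<in> e}"
  then obtain e where e: "E = tree_edge (trivial_walk v) e" "e \<in> edges H" "v \<in> e" by auto
  have "prepend v e (trivial_walk u) \<in> walks_from r H v" if u: "u \<in> e - {v}" for u
  proof -
    have "u \<in> verts (induced H (- earlier r v e u))"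
      using u e assms(1,2) by (auto simp: kgraph_def earlier_def irrefl_def)
    then show ?thesis
      using prepend_in_walks_from[OF assms(1,2) e(2,3) u] trivial_walk_in_walks_from by metis
  qed
  then have "E \<subseteq> walks_from r H v"
    using trivial_walk_in_walks_from[OF assms(3)] unfolding e(1) tree_edge_trivial by blast
  moreover have "walk_end (trivial_walk v) \<in> e" using e(3) by (simp add: walk_end_def trivial_walk_def)
  ultimately have "E \<in> edges (walk_tree r H v)" using e(1,2) unfolding edges_walk_tree by blast
  then show "E \<in> {E \<in> edges (walk_tree r H v). trivial_walk v \<in> E}"
    by (simp add: e(1) tree_edge_def)
qed

text \<open>Only edges through the root join different branches. With the root outside
  \<open>X\<close>, the first step is constant on every remaining edge and serves as
  colouring.\<close>

lemma matching_poly_branches: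
  assumes "k \<ge> 1" "kgraph k H" "finite (verts H)" "irrefl r" "trivial_walk v \<notin> X"
  shows "matching_poly k (induced (walk_tree r H v) X)
    = (\<Prod>e | e \<in> edges H \<and> v \<in> e. \<Prod>u\<in>e - {v}.
        matching_poly k (induced (walk_tree r H v) (X \<inter> branch v (e, u))))"
proof -
  let ?T = "walk_tree r H v"
  let ?I = "SIGMA e:{e \<in> edges H. v \<in> e}. e - {v}"
  have fe: "finite e" if "e \<in> edges H" for e
    using that assms(2,3) by (auto simp: kgraph_def intro: finite_subset)
  have step: "first_step w \<in> ?I" if "w \<in> walks_from r H v" "w \<noteq> trivial_walk v" for w
    using assms(2,4) that(1)
  proof (cases rule: walks_from_cases)
    case (2 e u w')
    then show ?thesis using walk_simps(1,2)[OF 2(5)] by (simp add: first_step_prepend)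
  qed (use that(2) in simp)
  have mono: "first_step x = first_step y"
    if E: "E \<in> edges (induced ?T X)" "x \<in> E" "y \<in> E" for E x y
  proof -
    obtain w f where w: "E = tree_edge w f" "w \<in> walks_from r H v" "E \<subseteq> X"
      using E(1) by (auto simp: edges_walk_tree tree_edge_def)
    then have "w \<noteq> trivial_walk v" using assms(5) by (auto simp: tree_edge_def)
    with assms(2,4) w(2) obtain e u w' where
      "w = prepend v e w'" "w' \<in> walks_from r (induced H (- earlier r v e u)) u"
      by (elim walks_from_cases) auto
    then have "w = prepend v e w'" "fst w' \<noteq> []" using walk_simps(1)[of w'] by auto
    then have "first_step z = (e, hd (fst w'))" if "z \<in> E" for z
      using that fst_tree_edge[of w'] by (auto simp: w(1) tree_edge_prepend first_step_prepend)
    then show ?thesis using E by simp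
  qed
  have "matching_poly k (induced ?T X)
      = (\<Prod>p\<in>?I. matching_poly k (induced (induced ?T X) {w. first_step w = p}))"
  proof (rule matching_poly_colour_classes[OF assms(1)])
    show "finite ?I" using fe finite_edges[OF assms(2,3)] by auto
    show "kgraph k (induced ?T X)" by (intro kgraph_induced kgraph_walk_tree assms(2,3))
    show "finite (verts (induced ?T X))" using finite_walk_tree[OF assms(2,3)] by simp
    show "first_step ` verts (induced ?T X) \<subseteq> ?I"
      using assms(5) by (intro image_subsetI step) (auto simp: verts_walk_tree)
  qed (rule mono)
  also have "\<dots> = (\<Prod>(e, u)\<in>?I. matching_poly k (induced ?T (X \<inter> branch v (e, u))))"
  proof (rule prod.cong)
    fix p assume "p \<in> ?I"
    \<comment> \<open>The junk value of \<open>first_step\<close> at the root does no harm, because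
      the root is not in \<open>X\<close>.\<close>
    have "X \<inter> {w. first_step w = p} = X \<inter> branch v p" using assms(5) by (auto simp: branch_def)
    then show "matching_poly k (induced (induced ?T X) {w. first_step w = p})
        = (case p of (e, u) \<Rightarrow> matching_poly k (induced ?T (X \<inter> branch v (e, u))))"
      by (simp split: prod.split)
  qed simp
  also have "\<dots> = (\<Prod>e | e \<in> edges H \<and> v \<in> e. \<Prod>u\<in>e - {v}.
        matching_poly k (induced ?T (X \<inter> branch v (e, u))))"
    using fe finite_edges[OF assms(2,3)] by (subst prod.Sigma) auto
  finally show ?thesis .
qed

lemma matching_poly_walk_tree_minus_root:
  assumes "k \<ge> 1" "kgraph k H" "finite (verts H)" "irrefl r"
  shows "matching_poly k (induced (walk_tree r H v) (- {trivial_walk v}))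
    = (\<Prod>e | e \<in> edges H \<and> v \<in> e. \<Prod>u\<in>e - {v}.
        matching_poly k (walk_tree r (induced H (- earlier r v e u)) u))"
proof -
  have "- {trivial_walk v} \<inter> branch v p = branch v p" for p by (auto simp: branch_def)
  then show ?thesis
    using matching_poly_branch[OF assms, where A = "{}"] assms
    by (subst matching_poly_branches) auto
qed

text \<open>Deleting the tree edge removes the root of the whole tree and the root of each branch
  (f, u); branches over other edges stay intact.\<close>

lemma matching_poly_walk_tree_minus_edge:
  assumes "k \<ge> 1" "kgraph k H" "finite (verts H)" "irrefl r" and f: "f \<in> edges H" "v \<in> f"
  shows "matching_poly k (induced (walk_tree r H v) (- tree_edge (trivial_walk v) f))
    = (\<Prod>u\<in>f - {v}. matching_poly k
        (induced (walk_tree r (induced H (- earlier r v f u)) u) (- {trivial_walk u})))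
    * (\<Prod>e\<in>{e \<in> edges H. v \<in> e} - {f}. \<Prod>u\<in>e - {v}.
        matching_poly k (walk_tree r (induced H (- earlier r v e u)) u))"
proof -
  let ?E = "{e \<in> edges H. v \<in> e}"
  let ?T = "walk_tree r H v"
  let ?X = "- tree_edge (trivial_walk v) f"
  have X: "?X \<inter> branch v (e, u) = branch v (e, u) - prepend v e ` (if e = f then {trivial_walk u} else {})"
    if "u \<in> e - {v}" for e u
    using that by (auto simp: branch_def tree_edge_trivial first_step_prepend)
      (auto simp: trivial_walk_def prepend_def first_step_def)
  have B: "matching_poly k (induced ?T (?X \<inter> branch v (e, u)))
      = matching_poly k (induced (walk_tree r (induced H (- earlier r v e u)) u)
          (- (if e = f then {trivial_walk u} else {})))"
    if "e \<in> ?E" "u \<in> e - {v}" for e u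
    unfolding X[OF that(2)] using that assms by (intro matching_poly_branch) auto
  have "trivial_walk v \<notin> ?X" by (simp add: tree_edge_def)
  then have "matching_poly k (induced ?T ?X) = (\<Prod>e\<in>?E. \<Prod>u\<in>e - {v}.
      matching_poly k (induced (walk_tree r (induced H (- earlier r v e u)) u)
          (- (if e = f then {trivial_walk u} else {}))))"
    using B by (subst matching_poly_branches[OF assms(1-4)]) (auto intro!: prod.cong)
  also have "\<dots> = (\<Prod>u\<in>f - {v}. matching_poly k
        (induced (walk_tree r (induced H (- earlier r v f u)) u) (- {trivial_walk u})))
    * (\<Prod>e\<in>?E - {f}. \<Prod>u\<in>e - {v}.
        matching_poly k (walk_tree r (induced H (- earlier r v e u)) u))"
    using f finite_edges[OF assms(2,3)] by (subst prod.remove[of _ f]) auto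
  finally show ?thesis .
qed

section \<open>The cross-multiplied identity, by induction on the number of vertices\<close>

text \<open>Cross-multiplication keeps the induction inside the polynomial ring. \<open>H\<close>
  and \<open>v\<close> vary while \<open>r\<close> is fixed, since \<open>r\<close> also orders
  every subset of the vertices.\<close>

lemma walk_tree_cross:
  assumes "k \<ge> 1" "kgraph k H" "finite (verts H)" "v \<in> verts H"
    and "strict_linear_order_on (verts H) r"
  shows "matching_poly k (induced H (- {v})) * matching_poly k (walk_tree r H v)
    = matching_poly k (induced (walk_tree r H v) (- {trivial_walk v})) * matching_poly k H"
  using assms(2-5)
proof (induction "card (verts H)" arbitrary: H v rule: less_induct)
  case less
  let ?T = "walk_tree r H v" and ?V = "trivial_walk v"
  let ?E = "{e \<in> edges H. v \<in> e}"
  let ?m = "\<lambda>S. matching_poly k (induced H (- S))"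
  let ?C = "earlier r v"
  let ?B = "\<lambda>e u. walk_tree r (induced H (- ?C e u)) u"
  let ?D = "\<lambda>e. \<Prod>u\<in>e - {v}. matching_poly k (?B e u)"
  let ?N = "\<lambda>e. \<Prod>u\<in>e - {v}. matching_poly k (induced (?B e u) (- {trivial_walk u}))"
  have r: "irrefl r" using less.prems(4) by (simp add: strict_linear_order_on_def)
  have sub: "strict_linear_order_on S r" if "S \<subseteq> verts H" for S
    using less.prems(4) that by (auto simp: strict_linear_order_on_def total_on_def)
  have T: "kgraph k ?T" "finite (verts ?T)"
    using kgraph_walk_tree[OF less.prems(1,2)] finite_walk_tree[OF less.prems(1,2)] by auto
  have fE: "finite ?E" using finite_edges[OF less.prems(1,2)] by simp
  \<comment> \<open>The quotient m(H - e) / m(H - v) equals the contribution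
    \<open>?N e / ?D e\<close> of the branches over \<open>e\<close>.\<close>
  have edge: "?N e * ?m {v} = ?D e * ?m e" if e: "e \<in> ?E" for e
  proof -
    let ?U = "e - {v}"
    let ?L = "\<lambda>u. {u' \<in> ?U. (u', u) \<in> r}"
    \<comment> \<open>With this choice \<open>?g {}\<close> is m(H - v) and \<open>?g ?U\<close> is
      m(H - e), the two ends of the telescoping product.\<close>
    let ?g = "\<lambda>S. ?m (insert v S)"
    have eH: "e \<subseteq> verts H" using e less.prems(1) by (auto simp: kgraph_def)
    have fU: "finite ?U" using eH less.prems(2) by (auto intro: finite_subset)
    have IH: "?g (insert u (?L u)) * matching_poly k (?B e u)
        = ?g (?L u) * matching_poly k (induced (?B e u) (- {trivial_walk u}))" if u: "u \<in> ?U" for u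
    proof -
      let ?H = "induced H (- ?C e u)"
      have "verts ?H \<subset> verts H" using less.prems(3) by (auto simp: earlier_def)
      then have "card (verts ?H) < card (verts H)" by (rule psubset_card_mono[OF less.prems(2)])
      moreover have "u \<in> verts ?H" using u eH r by (auto simp: earlier_def irrefl_def)
      ultimately have "matching_poly k (induced ?H (- {u})) * matching_poly k (?B e u)
          = matching_poly k (induced (?B e u) (- {trivial_walk u})) * matching_poly k ?H"
        using less.prems(1,2) by (intro less.hyps sub kgraph_induced) auto
      moreover have "- ?C e u \<inter> - {u} = - insert v (insert u (?L u))" "?C e u = insert v (?L u)"
        by (auto simp: earlier_def)
      ultimately show ?thesis by (simp add: mult.commute)
    qed
    \<comment> \<open>This common factor is cancelled after telescoping.\<close>
    have nz: "(\<Prod>u\<in>?U. ?g (?L u)) \<noteq> 0"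
      using fU by (simp add: matching_poly_nonzero[OF assms(1)])
    have "?N e * ?g {} * (\<Prod>u\<in>?U. ?g (?L u))
        = ?g {} * (\<Prod>u\<in>?U. ?g (?L u) * matching_poly k (induced (?B e u) (- {trivial_walk u})))"
      by (simp add: prod.distrib mult_ac)
    also have "\<dots> = ?g {} * (\<Prod>u\<in>?U. ?g (insert u (?L u)) * matching_poly k (?B e u))"
      by (simp only: IH cong: prod.cong)
    also have "\<dots> = ?D e * (?g {} * (\<Prod>u\<in>?U. ?g (insert u (?L u))))"
      by (simp add: prod.distrib mult_ac)
    also have "?g {} * (\<Prod>u\<in>?U. ?g (insert u (?L u))) = ?g ?U * (\<Prod>u\<in>?U. ?g (?L u))"
      using eH by (intro prod_telescope_order[where g = ?g] fU sub) auto
    finally have "?N e * ?g {} = ?D e * ?g ?U" using nz by (simp add: mult.assoc[symmetric])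
    moreover have "insert v ?U = e" using e by auto
    ultimately show ?thesis by simp
  qed
  \<comment> \<open>The branches over the other edges at \<open>v\<close> contribute the same factor
    \<open>?R\<close> on both sides, so \<open>edge\<close> carries over to the tree.\<close>
  have minus_edge: "?m {v} * matching_poly k (induced ?T (- tree_edge ?V e))
      = matching_poly k (induced ?T (- {?V})) * ?m e" if e: "e \<in> ?E" for e
  proof -
    let ?R = "\<Prod>e'\<in>?E - {e}. ?D e'"
    have "?m {v} * matching_poly k (induced ?T (- tree_edge ?V e)) = (?N e * ?m {v}) * ?R"
      using e less.prems(1,2) r assms(1) by (subst matching_poly_walk_tree_minus_edge) (auto simp: mult_ac)
    also have "\<dots> = (?D e * ?R) * ?m e" unfolding edge[OF e] by (simp only: mult_ac)
    also have "?D e * ?R = matching_poly k (induced ?T (- {?V}))"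
      using matching_poly_walk_tree_minus_root[OF assms(1) less.prems(1,2) r] prod.remove[OF fE e, of ?D]
      by simp
    finally show ?thesis .
  qed
  have inj: "inj_on (tree_edge ?V) ?E"
  proof (rule inj_on_inverseI)
    show "walk_end ` tree_edge ?V e = e" if "e \<in> ?E" for e
      using that by (intro walk_end_tree_edge) (simp add: walk_end_def trivial_walk_def)
  qed
  \<comment> \<open>The recurrence at the root is multiplied by m(H - v); \<open>minus_edge\<close>
    then lets the polynomial of the tree without its root be factored out, and what remains is the
    recurrence for \<open>H\<close> at \<open>v\<close>.\<close>
  have "matching_poly k ?T = monom 1 1 * matching_poly k (induced ?T (- {?V}))
      - (\<Sum>E | E \<in> edges ?T \<and> ?V \<in> E. matching_poly k (induced ?T (- E)))"
    using trivial_walk_in_walks_from less.prems(3)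
    by (intro matching_poly_vertex[OF assms(1) T]) (simp add: verts_walk_tree)
  also have "(\<Sum>E | E \<in> edges ?T \<and> ?V \<in> E. matching_poly k (induced ?T (- E)))
      = (\<Sum>e\<in>?E. matching_poly k (induced ?T (- tree_edge ?V e)))"
    unfolding edges_walk_tree_root[OF less.prems(1) r less.prems(3)] sum.reindex[OF inj] by simp
  finally have "?m {v} * matching_poly k ?T = monom 1 1 * ?m {v} * matching_poly k (induced ?T (- {?V}))
      - (\<Sum>e\<in>?E. ?m {v} * matching_poly k (induced ?T (- tree_edge ?V e)))"
    by (simp add: right_diff_distrib sum_distrib_left mult_ac)
  also have "\<dots> = monom 1 1 * ?m {v} * matching_poly k (induced ?T (- {?V}))
      - (\<Sum>e\<in>?E. matching_poly k (induced ?T (- {?V})) * ?m e)"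
    by (simp only: minus_edge cong: sum.cong)
  also have "\<dots> = matching_poly k (induced ?T (- {?V})) * (monom 1 1 * ?m {v} - (\<Sum>e\<in>?E. ?m e))"
    by (simp add: right_diff_distrib sum_distrib_left mult_ac)
  also have "monom 1 1 * ?m {v} - (\<Sum>e\<in>?E. ?m e) = matching_poly k H"
    using matching_poly_vertex[OF assms(1) less.prems(1-3)] by simp
  finally show ?case .
qed

text \<open>Both denominators are nonzero, so equality of the fractions is the identity
  \<open>walk_tree_cross\<close>.\<close>

theorem theorem3p5:
  fixes H :: "'a hypergraph" and k :: nat and v :: 'a and r :: "'a rel"
  assumes "k \<ge> 1"
    and "kgraph k H"
    and "finite (verts H)"
    and "v \<in> verts H"
    and "strict_linear_order_on (verts H) r"
  shows "Fraction_Field.Fract (matching_poly k (del_vertex H v)) (matching_poly k H) =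
         Fraction_Field.Fract
           (matching_poly k (del_vertex (walk_tree r H v) (trivial_walk v)))
           (matching_poly k (walk_tree r H v))"
  using walk_tree_cross[OF assms]
  by (simp add: eq_fract del_vertex_eq_induced matching_poly_nonzero[OF assms(1)])

end
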